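(* Let $l\in\{1,2,3\}$ and let $k\geq l$ be an integer. Let $T$ be a doubly regular tournament of order $4k+3$. Then every tournament obtained from $T$ by removing $l$ vertices has simplicity index exactly $(2k+1)-l$.
   Context: A tournament $T=(V,A)$ consists of a finite vertex set $V$ and a set $A$ of ordered pairs of distinct vertices (arcs) such that for all $x\neq y\in V$, $(x,y)\in A$ if and only if $(y,x)\notin A$. One writes $x\rightarrow y$ ($x$ dominates $y$) when $(x,y)\in A$. The order of a tournament is its number of vertices. A tournament is doubly regular if there is an integer $m\geq 1$ such that for every unordered pair $\{x,y\}$ of distinct vertices there are exactly $m$ vertices $z$ with $x\rightarrow z$ and $y\rightarrow z$. Removing vertices from $T$ means taking the subtournament induced by the remaining vertices. A module of $T$ is a subset $M\subseteq V$ such that for every $x\in V\setminus M$, either $m\rightarrow x$ for all $m\in M$, or $x\rightarrow m$ for all $m\in M$. The trivial modules are $\emptyset$, the singletons and $V$. A tournament with $n$ vertices is simple if $n\geq 3$ and all its modules are trivial. For a tournament $T$ with at least $3$ vertices, the simplicity index $s(T)$ is the minimum number of arcs of $T$ whose reversal yields a non-simple tournament (so $s(T)=0$ if $T$ is not simple). *)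

theory Defs
  imports "Graph_Theory.Graph_Theory"
begin

(* pair_digraph: finitely many vertices, arcs are pairs of distinct vertices. *)
locale tournament = pair_digraph T for T :: "'a pair_pre_digraph" +
  assumes arc_iff_not_converse:
    "\<lbrakk>x \<in> pverts T; y \<in> pverts T; x \<noteq> y\<rbrakk> \<Longrightarrow> (x, y) \<in> parcs T \<longleftrightarrow> (y, x) \<notin> parcs T"

definition doubly_regular :: "'a pair_pre_digraph \<Rightarrow> bool" where
  "doubly_regular T \<longleftrightarrow> tournament T \<and>
     (\<exists>m::nat. m \<ge> 1 \<and>
       (\<forall>x \<in> pverts T. \<forall>y \<in> pverts T. x \<noteq> y \<longrightarrow>
          card {z \<in> pverts T. (x, z) \<in> parcs T \<and> (y, z) \<in> parcs T} = m))"

definition remove_verts :: "'a pair_pre_digraph \<Rightarrow> 'a set \<Rightarrow> 'a pair_pre_digraph" where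
  "remove_verts T R =
     \<lparr> pverts = pverts T - R, parcs = {(x, y) \<in> parcs T. x \<notin> R \<and> y \<notin> R} \<rparr>"

definition graph_module :: "'a pair_pre_digraph \<Rightarrow> 'a set \<Rightarrow> bool" where
  "graph_module T M \<longleftrightarrow> M \<subseteq> pverts T \<and>
     (\<forall>x \<in> pverts T - M. (\<forall>m \<in> M. (m, x) \<in> parcs T) \<or> (\<forall>m \<in> M. (x, m) \<in> parcs T))"

definition trivial_module :: "'a pair_pre_digraph \<Rightarrow> 'a set \<Rightarrow> bool" where
  "trivial_module T M \<longleftrightarrow> M = {} \<or> (\<exists>x \<in> pverts T. M = {x}) \<or> M = pverts T"

definition simple_tournament :: "'a pair_pre_digraph \<Rightarrow> bool" where
  "simple_tournament T \<longleftrightarrow> tournament T \<and> card (pverts T) \<ge> 3 \<and>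
     (\<forall>M. graph_module T M \<longrightarrow> trivial_module T M)"

definition reverse_arcs :: "'a pair_pre_digraph \<Rightarrow> ('a \<times> 'a) set \<Rightarrow> 'a pair_pre_digraph" where
  "reverse_arcs T B = \<lparr> pverts = pverts T, parcs = (parcs T - B) \<union> B\<inverse> \<rparr>"

(* Only meaningful for tournaments with at least 3 vertices; then the minimum is attained,
   see simplicity_index_attained. *)
definition simplicity_index :: "'a pair_pre_digraph \<Rightarrow> nat" where
  "simplicity_index T =
     (LEAST n. \<exists>B \<subseteq> parcs T. card B = n \<and> \<not> simple_tournament (reverse_arcs T B))"

lemma with_proj_remove_verts:
  assumes "tournament T"
  shows "with_proj (remove_verts T R) = with_proj T \<restriction> (pverts T - R)"
proof -
  interpret tournament T by fact
  show ?thesis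
    by (auto simp: remove_verts_def with_proj_def induce_subgraph_def dest: in_arcsD1 in_arcsD2)
qed

lemma tournament_iff:
  "tournament T \<longleftrightarrow> finite (pverts T) \<and> parcs T \<subseteq> pverts T \<times> pverts T \<and>
     (\<forall>x. (x, x) \<notin> parcs T) \<and>
     (\<forall>x \<in> pverts T. \<forall>y \<in> pverts T. x \<noteq> y \<longrightarrow> ((x, y) \<in> parcs T \<longleftrightarrow> (y, x) \<notin> parcs T))"
    (is "_ \<longleftrightarrow> ?R")
proof
  assume "tournament T"
  then interpret tournament T .
  have "\<forall>x. (x, x) \<notin> parcs T"
    using no_loops' by blast
  moreover have "parcs T \<subseteq> pverts T \<times> pverts T"
    using in_arcsD1 in_arcsD2 by (intro subrelI) simp
  moreover have "\<forall>x \<in> pverts T. \<forall>y \<in> pverts T. x \<noteq> y \<longrightarrow> ((x, y) \<in> parcs T \<longleftrightarrow> (y, x) \<notin> parcs T)"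
    by (intro ballI impI, rule arc_iff_not_converse)
  ultimately show ?R
    using pair_finite_verts by blast
next
  assume R: ?R
  then have V: "finite (pverts T)" and A: "parcs T \<subseteq> pverts T \<times> pverts T"
    and irrefl: "(x, x) \<notin> parcs T" for x
    by blast+
  have fin: "finite (parcs T)"
    by (rule finite_subset[OF A]) (simp add: V)
  have sub: "fst e \<in> pverts T" "snd e \<in> pverts T" "fst e \<noteq> snd e" if "e \<in> parcs T" for e
    using A irrefl that by (cases e; fastforce)+
  have iff: "(x, y) \<in> parcs T \<longleftrightarrow> (y, x) \<notin> parcs T"
    if "x \<in> pverts T" "y \<in> pverts T" "x \<noteq> y" for x y
    using R that by blast
  show "tournament T"
    by unfold_locales (fact V fin sub iff)+
qed

lemma tournament_remove_verts:
  assumes "tournament T"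
  shows "tournament (remove_verts T R)"
  using assms unfolding tournament_iff remove_verts_def pair_pre_digraph.simps by blast

lemma tournament_reverse_arcs:
  assumes "tournament T" "B \<subseteq> parcs T"
  shows "tournament (reverse_arcs T B)"
  using assms unfolding tournament_iff reverse_arcs_def pair_pre_digraph.simps by blast

lemma simplicity_index_attained:
  assumes "tournament T" "card (pverts T) \<ge> 3"
  shows "\<exists>B \<subseteq> parcs T. card B = simplicity_index T \<and> \<not> simple_tournament (reverse_arcs T B)"
proof -
  interpret tournament T by fact
  obtain v where v: "v \<in> pverts T"
    using assms(2) by fastforce
  define B where "B = {(x, y) \<in> parcs T. y = v}"
  define M where "M = pverts T - {v}"
  have "(v, m) \<in> parcs (reverse_arcs T B)" if "m \<in> M" for m
    using that v arc_iff_not_converse[of v m] by (auto simp: reverse_arcs_def B_def M_def)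
  then have "graph_module (reverse_arcs T B) M"
    by (auto simp: graph_module_def M_def reverse_arcs_def)
  moreover have "card M \<ge> 2"
    using assms(2) v pair_finite_verts by (simp add: M_def)
  then have "M \<noteq> {}" "M \<noteq> {x}" for x
    by auto
  then have "\<not> trivial_module (reverse_arcs T B) M"
    using v by (simp add: trivial_module_def reverse_arcs_def) (auto simp: M_def)
  ultimately have "\<not> simple_tournament (reverse_arcs T B)"
    by (auto simp: simple_tournament_def)
  moreover have "B \<subseteq> parcs T"
    by (auto simp: B_def)
  ultimately have "\<exists>n. \<exists>B \<subseteq> parcs T. card B = n \<and> \<not> simple_tournament (reverse_arcs T B)"
    by blast
  then show ?thesis
    unfolding simplicity_index_def by (rule LeastI_ex)
qed

end

theory Submission
  imports Defs
begin

text \<open>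
  Call a third vertex \<open>z\<close> a separator of a pair \<open>a, b\<close> if it dominates exactly one of them. In a doubly
  regular tournament of order \<open>4k + 3\<close> every pair has \<open>2k + 1\<close> separators, so for a vertex set \<open>M\<close>
  of size \<open>m\<close>, with \<open>p\<^sub>z\<close> and \<open>q\<^sub>z\<close> the numbers of out- and in-neighbours of \<open>z\<close> in \<open>M\<close>,
  double counting gives \<open>\<Sum>\<^sub>z p\<^sub>z q\<^sub>z = m (m - 1) (2k + 1) / 2\<close>.

  Lower bound: to turn \<open>M\<close> into a module one must reverse at least \<open>min p\<^sub>z q\<^sub>z \<ge> p\<^sub>z q\<^sub>z / (m - 1)\<close>
  arcs at each remaining vertex \<open>z\<close> outside \<open>M\<close>. The vertices of \<open>M\<close> and the removed vertices
  contribute at most \<open>(m - 1)\<^sup>2 / 4\<close> and \<open>m\<^sup>2 / 4\<close> to the sum, which leaves at least \<open>2k + 1 - l\<close>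
  reversals unless \<open>M\<close> misses just one vertex; in that case the degree of this vertex gives the bound.

  Upper bound: by the same count with \<open>M\<close> the set of removed vertices, some other vertex dominates
  all removed vertices or is dominated by all of them; making it a source or a sink of the
  remaining tournament takes \<open>2k + 1 - l\<close> reversals.
\<close>

section \<open>Neighbourhoods and arc counts in a tournament\<close>

context tournament
begin

abbreviation out_nbrs :: "'a \<Rightarrow> 'a set" where
  "out_nbrs x \<equiv> {y. (x, y) \<in> parcs T}"

abbreviation in_nbrs :: "'a \<Rightarrow> 'a set" where
  "in_nbrs x \<equiv> {y. (y, x) \<in> parcs T}"

lemma arc_verts: "(x, y) \<in> parcs T \<Longrightarrow> x \<in> pverts T \<and> y \<in> pverts T \<and> x \<noteq> y"
  using in_arcsD1 in_arcsD2 no_loops' by blast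

lemma arc_asym: "(x, y) \<in> parcs T \<Longrightarrow> (y, x) \<notin> parcs T"
  using arc_verts arc_iff_not_converse by blast

lemma arc_total: "x \<in> pverts T \<Longrightarrow> y \<in> pverts T \<Longrightarrow> x \<noteq> y \<Longrightarrow> (x, y) \<in> parcs T \<or> (y, x) \<in> parcs T"
  using arc_iff_not_converse by blast

lemma finite_nbrs [simp]: "finite (out_nbrs x)" "finite (in_nbrs x)"
  by (rule finite_subset[OF _ pair_finite_verts]; use arc_verts in blast)+

lemma card_nbrs_Int:
  assumes "M \<subseteq> pverts T" "z \<in> pverts T"
  shows "card (M \<inter> out_nbrs z) + card (M \<inter> in_nbrs z) = card (M - {z})"
proof -
  have "M - {z} = (M \<inter> out_nbrs z) \<union> (M \<inter> in_nbrs z)"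
    using assms arc_total arc_verts by blast
  moreover have "(M \<inter> out_nbrs z) \<inter> (M \<inter> in_nbrs z) = {}"
    using arc_asym by blast
  ultimately show ?thesis
    by (simp add: card_Un_disjoint)
qed

text \<open>Out-degrees and in-degrees within \<open>M\<close> have the same sum, the number of arcs
  inside \<open>M\<close>, and each vertex contributes \<open>card M - 1\<close> to the two sums
  together.\<close>

lemma sum_card_out_nbrs_Int:
  assumes "M \<subseteq> pverts T"
  shows "2 * (\<Sum>x\<in>M. card (M \<inter> out_nbrs x)) = card M * (card M - 1)"
proof -
  have fin: "finite M"
    using assms pair_finite_verts finite_subset by blast
  have "(\<Sum>x\<in>M. card (M \<inter> out_nbrs x)) = (\<Sum>x\<in>M. card (M \<inter> in_nbrs x))"
    using sum_multicount_gen[of M M "\<lambda>x y. (x, y) \<in> parcs T" "\<lambda>y. card (M \<inter> in_nbrs y)"] fin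
    by (simp add: Int_def)
  then have "2 * (\<Sum>x\<in>M. card (M \<inter> out_nbrs x))
      = (\<Sum>x\<in>M. card (M \<inter> out_nbrs x) + card (M \<inter> in_nbrs x))"
    by (simp add: sum.distrib)
  also have "\<dots> = (\<Sum>x\<in>M. card M - 1)"
    by (rule sum.cong) (use assms fin in \<open>auto simp: card_nbrs_Int[OF assms subsetD[OF assms]]\<close>)
  finally show ?thesis
    by simp
qed

section \<open>Degrees and separators in doubly regular tournaments\<close>

text \<open>The common out-neighbour count of \<open>x\<close> and \<open>y\<close> is the score of \<open>y\<close> in the subtournament induced by
  the out-neighbourhood of \<open>x\<close>, so this subtournament is regular.\<close>

lemma doubly_regular_parameters:
  assumes dr: "doubly_regular T" and card_V: "card (pverts T) = 4 * k + 3"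
  shows "x \<in> pverts T \<Longrightarrow> card (out_nbrs x) = 2 * k + 1"
    and "x \<in> pverts T \<Longrightarrow> y \<in> pverts T \<Longrightarrow> x \<noteq> y \<Longrightarrow> card (out_nbrs x \<inter> out_nbrs y) = k"
proof -
  obtain m where m: "m \<ge> 1" and common0: "\<And>x y. x \<in> pverts T \<Longrightarrow> y \<in> pverts T \<Longrightarrow> x \<noteq> y \<Longrightarrow>
      card {z \<in> pverts T. (x, z) \<in> parcs T \<and> (y, z) \<in> parcs T} = m"
    using dr unfolding doubly_regular_def by blast
  have common: "card (out_nbrs x \<inter> out_nbrs y) = m"
    if "x \<in> pverts T" "y \<in> pverts T" "x \<noteq> y" for x y
  proof -
    have "out_nbrs x \<inter> out_nbrs y = {z \<in> pverts T. (x, z) \<in> parcs T \<and> (y, z) \<in> parcs T}"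
      using arc_verts by blast
    then show ?thesis
      using common0[OF that] by simp
  qed
  have out: "card (out_nbrs x) = 2 * m + 1" if x: "x \<in> pverts T" for x
  proof -
    have "card (pverts T - {x}) > 0"
      using x card_V pair_finite_verts by simp
    then obtain y where y: "y \<in> pverts T" "y \<noteq> x"
      by (metis DiffE card_gt_0_iff ex_in_conv singletonI)
    \<comment> \<open>This is where \<open>m\<close> being positive enters: the degree is nonzero
      and can be cancelled from the arc count below.\<close>
    have "out_nbrs x \<noteq> {}"
      using common[OF x y(1)] y m by force
    then obtain d where d: "card (out_nbrs x) = Suc d"
      by (metis card_gt_0_iff finite_nbrs(1) gr0_implies_Suc)
    have "out_nbrs x \<subseteq> pverts T"
      using arc_verts by blast
    from sum_card_out_nbrs_Int[OF this]
    have "2 * (\<Sum>y\<in>out_nbrs x. m) = card (out_nbrs x) * (card (out_nbrs x) - 1)"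
      using x arc_verts by (subst (asm) sum.cong[OF refl common]) auto
    then have "(2 * m) * Suc d = d * Suc d"
      by (simp add: d algebra_simps)
    then show ?thesis
      unfolding d by (subst (asm) mult_cancel2) simp
  qed
  have "pverts T \<inter> out_nbrs x = out_nbrs x" for x
    using arc_verts by blast
  \<comment> \<open>Counting all arcs of \<open>T\<close> by their tails now identifies
    \<open>m\<close> with \<open>k\<close>.\<close>
  then have "2 * (\<Sum>x\<in>pverts T. 2 * m + 1) = card (pverts T) * (card (pverts T) - 1)"
    using sum_card_out_nbrs_Int[of "pverts T"] out by simp
  then have "(4 * k + 3) * (2 * (2 * m + 1)) = (4 * k + 3) * (4 * k + 2)"
    unfolding card_V by (simp add: card_V algebra_simps)
  then have "2 * (2 * m + 1) = 4 * k + 2"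
    by (subst (asm) mult_cancel1) simp
  then have "m = k"
    by simp
  then show "x \<in> pverts T \<Longrightarrow> card (out_nbrs x) = 2 * k + 1"
    and "x \<in> pverts T \<Longrightarrow> y \<in> pverts T \<Longrightarrow> x \<noteq> y \<Longrightarrow> card (out_nbrs x \<inter> out_nbrs y) = k"
    using out common by auto
qed

lemma card_in_nbrs_doubly_regular:
  assumes "doubly_regular T" "card (pverts T) = 4 * k + 3" "x \<in> pverts T"
  shows "card (in_nbrs x) = 2 * k + 1"
proof -
  have "pverts T \<inter> out_nbrs x = out_nbrs x" "pverts T \<inter> in_nbrs x = in_nbrs x"
    using arc_verts by blast+
  then show ?thesis
    using card_nbrs_Int[of "pverts T" x] doubly_regular_parameters(1)[OF assms] assms
    by (simp add: pair_finite_verts)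
qed

text \<open>Of the \<open>2 * k + 1\<close> out-neighbours of \<open>b\<close>, \<open>k\<close> are
  shared with \<open>a\<close>, and \<open>a\<close> itself is one iff \<open>b\<close> dominates
  \<open>a\<close>; the rest dominate \<open>a\<close>. So one of the two terms is \<open>k\<close>
  and the other \<open>k + 1\<close>.\<close>

lemma card_separators:
  assumes "doubly_regular T" "card (pverts T) = 4 * k + 3"
    and a: "a \<in> pverts T" and b: "b \<in> pverts T" and ne: "a \<noteq> b"
  shows "card (in_nbrs a \<inter> out_nbrs b) + card (in_nbrs b \<inter> out_nbrs a) = 2 * k + 1"
proof -
  have *: "card (in_nbrs a \<inter> out_nbrs b) = k + (if (b, a) \<in> parcs T then 0 else 1)"
    if "a \<in> pverts T" "b \<in> pverts T" "a \<noteq> b" for a b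
  proof -
    have "out_nbrs b = (in_nbrs a \<inter> out_nbrs b) \<union>
        ((out_nbrs a \<inter> out_nbrs b) \<union> (if (b, a) \<in> parcs T then {a} else {}))"
      using arc_total arc_verts that by auto
    also have "card \<dots> = card (in_nbrs a \<inter> out_nbrs b) +
        (card (out_nbrs a \<inter> out_nbrs b) + (if (b, a) \<in> parcs T then 1 else 0))"
      using arc_asym arc_verts
      by (subst card_Un_disjoint, simp, simp, force, subst card_Un_disjoint) auto
    finally show ?thesis
      using doubly_regular_parameters(1)[OF assms(1,2), of b]
        doubly_regular_parameters(2)[OF assms(1,2), of a b] that by (auto split: if_splits)
  qed
  show ?thesis
    using *[OF a b ne] *[OF b a] ne arc_iff_not_converse[OF a b ne] by auto
qed

text \<open>Both sides count, with factor 2, the paths \<open>b\<close>, \<open>z\<close>,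
  \<open>a\<close> with ends in \<open>M\<close>: by middle vertex on the left, by pair of ends on
  the right.\<close>

lemma sum_out_in_nbrs_Int:
  assumes "doubly_regular T" "card (pverts T) = 4 * k + 3" and M: "M \<subseteq> pverts T"
  shows "2 * (\<Sum>z\<in>pverts T. card (M \<inter> out_nbrs z) * card (M \<inter> in_nbrs z))
    = card M * (card M - 1) * (2 * k + 1)"
proof -
  define D where "D a b = card (in_nbrs a \<inter> out_nbrs b)" for a b
  have fin: "finite M"
    using M pair_finite_verts finite_subset by blast
  have diag: "D a a = 0" for a
    using arc_asym by (auto simp: D_def)
  have "(\<Sum>z\<in>pverts T. card (M \<inter> out_nbrs z) * card (M \<inter> in_nbrs z))
      = (\<Sum>z\<in>pverts T. card {e \<in> M \<times> M. (z, fst e) \<in> parcs T \<and> (snd e, z) \<in> parcs T})"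
    by (intro sum.cong refl, subst card_cartesian_product[symmetric], intro arg_cong[where f = card])
      auto
  also have "\<dots> = (\<Sum>e\<in>M \<times> M. D (fst e) (snd e))"
  proof (rule sum_multicount_gen)
    show "\<forall>e\<in>M \<times> M. card {z \<in> pverts T. (z, fst e) \<in> parcs T \<and> (snd e, z) \<in> parcs T}
        = D (fst e) (snd e)"
      unfolding D_def using arc_verts by (auto intro!: arg_cong[where f = card])
  qed (use fin pair_finite_verts in auto)
  also have "\<dots> = (\<Sum>a\<in>M. \<Sum>b\<in>M. D a b)"
    by (simp add: sum.cartesian_product case_prod_unfold)
  finally have S: "(\<Sum>z\<in>pverts T. card (M \<inter> out_nbrs z) * card (M \<inter> in_nbrs z))
      = (\<Sum>a\<in>M. \<Sum>b\<in>M. D a b)" .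
  \<comment> \<open>\<open>D a b\<close> depends on the direction of the arc between
    \<open>a\<close> and \<open>b\<close>, but \<open>D a b + D b a\<close> does not.\<close>
  have "2 * (\<Sum>a\<in>M. \<Sum>b\<in>M. D a b) = (\<Sum>a\<in>M. \<Sum>b\<in>M. D a b) + (\<Sum>a\<in>M. \<Sum>b\<in>M. D b a)"
    using sum.swap[of D M M] by simp
  also have "\<dots> = (\<Sum>a\<in>M. \<Sum>b\<in>M. D a b + D b a)"
    by (simp add: sum.distrib)
  also have "\<dots> = (\<Sum>a\<in>M. \<Sum>b\<in>M - {a}. 2 * k + 1)"
  proof (rule sum.cong[OF refl])
    fix a assume a: "a \<in> M"
    have "(\<Sum>b\<in>M. D a b + D b a) = (\<Sum>b\<in>M - {a}. D a b + D b a)"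
      using fin a diag by (simp add: sum.remove[of M a])
    also have "\<dots> = (\<Sum>b\<in>M - {a}. 2 * k + 1)"
      using card_separators[OF assms(1,2)] a M unfolding D_def by (intro sum.cong) auto
    finally show "(\<Sum>b\<in>M. D a b + D b a) = (\<Sum>b\<in>M - {a}. 2 * k + 1)" .
  qed
  also have "\<dots> = (\<Sum>a\<in>M. (card M - 1) * (2 * k + 1))"
    by (intro sum.cong refl) (use fin in simp)
  also have "\<dots> = card M * (card M - 1) * (2 * k + 1)"
    by (simp only: sum_constant of_nat_id mult.assoc)
  finally show ?thesis
    using S by simp
qed

section \<open>Modules created by reversing arcs\<close>

lemma simplicity_index_le:
  assumes "B \<subseteq> parcs T" "graph_module (reverse_arcs T B) M" "\<not> trivial_module T M"
  shows "simplicity_index T \<le> card B"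
  unfolding simplicity_index_def
proof (rule Least_le, intro exI conjI)
  show "\<not> simple_tournament (reverse_arcs T B)"
    using assms by (auto simp: simple_tournament_def trivial_module_def reverse_arcs_def)
qed (use assms in auto)

lemma not_trivial_module_delete:
  assumes "card (pverts T) \<ge> 3" and v: "v \<in> pverts T"
  shows "\<not> trivial_module T (pverts T - {v})"
proof -
  define M where "M = pverts T - {v}"
  have "card M \<ge> 2"
    using assms pair_finite_verts by (simp add: M_def)
  then have "M \<noteq> {}" "M \<noteq> {x}" for x
    by auto
  then have "pverts T - {v} \<noteq> {}" "pverts T - {v} \<noteq> {x}" for x
    unfolding M_def by blast+
  then show ?thesis
    using v by (auto simp: trivial_module_def)
qed

text \<open>Reversing all arcs into \<open>v\<close> makes it a source, so its complement becomes a
  module.\<close>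

lemma simplicity_index_le_in_degree:
  assumes "card (pverts T) \<ge> 3" and v: "v \<in> pverts T"
  shows "simplicity_index T \<le> card (in_nbrs v)"
proof -
  define B where "B = (\<lambda>x. (x, v)) ` in_nbrs v"
  have "(v, x) \<in> parcs (reverse_arcs T B)" if "x \<in> pverts T - {v}" for x
    using that v arc_total[of v x] by (auto simp: reverse_arcs_def B_def)
  then have "graph_module (reverse_arcs T B) (pverts T - {v})"
    by (auto simp: graph_module_def reverse_arcs_def)
  then have "simplicity_index T \<le> card B"
    using not_trivial_module_delete[OF assms] by (intro simplicity_index_le) (auto simp: B_def)
  also have "\<dots> = card (in_nbrs v)"
    unfolding B_def by (rule card_image) (auto simp: inj_on_def)
  finally show ?thesis .
qed

lemma simplicity_index_le_out_degree:
  assumes "card (pverts T) \<ge> 3" and v: "v \<in> pverts T"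
  shows "simplicity_index T \<le> card (out_nbrs v)"
proof -
  define B where "B = Pair v ` out_nbrs v"
  have "(x, v) \<in> parcs (reverse_arcs T B)" if "x \<in> pverts T - {v}" for x
    using that v arc_total[of v x] by (auto simp: reverse_arcs_def B_def)
  then have "graph_module (reverse_arcs T B) (pverts T - {v})"
    by (auto simp: graph_module_def reverse_arcs_def)
  then have "simplicity_index T \<le> card B"
    using not_trivial_module_delete[OF assms] by (intro simplicity_index_le) (auto simp: B_def)
  also have "\<dots> = card (out_nbrs v)"
    unfolding B_def by (rule card_image) (auto simp: inj_on_def)
  finally show ?thesis .
qed

text \<open>For each \<open>x\<close> outside \<open>M\<close>, \<open>B\<close> must contain either
  all arcs from \<open>x\<close> to \<open>M\<close> or all arcs from \<open>M\<close> to
  \<open>x\<close>.\<close>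

lemma sum_min_nbrs_le_reversals:
  assumes B: "B \<subseteq> parcs T" and M: "graph_module (reverse_arcs T B) M"
  shows "(\<Sum>x\<in>pverts T - M. min (card (M \<inter> out_nbrs x)) (card (M \<inter> in_nbrs x))) \<le> card B"
proof -
  define C where "C x = B \<inter> ({x} \<times> M \<union> M \<times> {x})" for x
  have fin: "finite B"
    using B pair_finite_arcs finite_subset by blast
  have "min (card (M \<inter> out_nbrs x)) (card (M \<inter> in_nbrs x)) \<le> card (C x)"
    if x: "x \<in> pverts T - M" for x
  proof -
    consider "\<forall>a\<in>M. (a, x) \<in> parcs (reverse_arcs T B)" | "\<forall>a\<in>M. (x, a) \<in> parcs (reverse_arcs T B)"
      using M x unfolding graph_module_def by (auto simp: reverse_arcs_def)
    then show ?thesis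
    proof cases
      case 1
      then have "Pair x ` (M \<inter> out_nbrs x) \<subseteq> C x"
        using arc_asym by (auto simp: reverse_arcs_def C_def)
      then have "card (Pair x ` (M \<inter> out_nbrs x)) \<le> card (C x)"
        using fin by (intro card_mono) (auto simp: C_def)
      then show ?thesis
        by (simp add: card_image inj_on_def)
    next
      case 2
      then have "(\<lambda>a. (a, x)) ` (M \<inter> in_nbrs x) \<subseteq> C x"
        using arc_asym by (auto simp: reverse_arcs_def C_def)
      then have "card ((\<lambda>a. (a, x)) ` (M \<inter> in_nbrs x)) \<le> card (C x)"
        using fin by (intro card_mono) (auto simp: C_def)
      then show ?thesis
        by (simp add: card_image inj_on_def)
    qed
  qed
  then have "(\<Sum>x\<in>pverts T - M. min (card (M \<inter> out_nbrs x)) (card (M \<inter> in_nbrs x)))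
      \<le> (\<Sum>x\<in>pverts T - M. card (C x))"
    by (rule sum_mono)
  \<comment> \<open>The sets \<open>C x\<close> are disjoint because each of their arcs has exactly
    one end outside \<open>M\<close>.\<close>
  also have "\<dots> = card (\<Union>x\<in>pverts T - M. C x)"
    using fin pair_finite_verts by (subst card_UN_disjoint) (auto simp: C_def)
  also have "\<dots> \<le> card B"
    using fin by (intro card_mono) (auto simp: C_def)
  finally show ?thesis .
qed

section \<open>Consequences of the double count\<close>

lemma exists_homogeneous_vertex:
  assumes dr: "doubly_regular T" and card_V: "card (pverts T) = 4 * k + 3"
    and R: "R \<subseteq> pverts T" and l: "card R \<in> {1, 2, 3}" "k \<ge> card R"
  shows "\<exists>v\<in>pverts T - R. R \<subseteq> out_nbrs v \<or> R \<subseteq> in_nbrs v"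
proof (rule ccontr)
  assume neg: "\<not> ?thesis"
  let ?l = "card R"
  have fin: "finite R"
    using R pair_finite_verts finite_subset by blast
  have card_diff: "card (pverts T - R) = 4 * k + 3 - ?l"
    using R fin card_V by (simp add: card_Diff_subset)
  \<comment> \<open>Two positive integers with sum \<open>card R\<close> have product at least
    \<open>card R - 1\<close>, and cannot exist when \<open>card R\<close> is 1.\<close>
  have pq: "card (R \<inter> out_nbrs z) * card (R \<inter> in_nbrs z) \<ge> ?l - 1 \<and> ?l \<ge> 2"
    if z: "z \<in> pverts T - R" for z
  proof -
    have sum: "card (R \<inter> out_nbrs z) + card (R \<inter> in_nbrs z) = ?l"
      using card_nbrs_Int[OF R, of z] z by simp
    have "R \<inter> out_nbrs z \<noteq> {}" "R \<inter> in_nbrs z \<noteq> {}"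
      using neg z arc_total R by blast+
    then have "card (R \<inter> out_nbrs z) > 0" "card (R \<inter> in_nbrs z) > 0"
      using fin by (simp_all add: card_gt_0_iff)
    then obtain p q where "card (R \<inter> out_nbrs z) = Suc p" "card (R \<inter> in_nbrs z) = Suc q"
      by (meson gr0_implies_Suc)
    then show ?thesis
      using sum by auto
  qed
  have "pverts T - R \<noteq> {}"
    using card_diff l by fastforce
  then have l2: "?l \<ge> 2"
    using pq by blast
  have "(4 * k + 3 - ?l) * (?l - 1) = (\<Sum>z\<in>pverts T - R. ?l - 1)"
    using card_diff by simp
  also have "\<dots> \<le> (\<Sum>z\<in>pverts T - R. card (R \<inter> out_nbrs z) * card (R \<inter> in_nbrs z))"
    using pq by (intro sum_mono) auto
  also have "\<dots> \<le> (\<Sum>z\<in>pverts T. card (R \<inter> out_nbrs z) * card (R \<inter> in_nbrs z))"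
    using pair_finite_verts by (intro sum_mono2) auto
  finally have "2 * ((4 * k + 3 - ?l) * (?l - 1)) \<le> ?l * (?l - 1) * (2 * k + 1)"
    using sum_out_in_nbrs_Int[OF dr card_V R] by linarith
  \<comment> \<open>For two removed vertices this reads 4k + 1 \<le> 2k + 1, for three 16k \<le> 12k
    + 6.\<close>
  then show False
    using l l2 by auto
qed

text \<open>\<open>M\<close> is an arbitrary vertex set here. Integers replace naturals so that
  differences do not truncate.\<close>

lemma nonsimple_reversal_bound:
  assumes dr: "doubly_regular T" and card_V: "card (pverts T) = 4 * k + 3"
    and R: "R \<subseteq> pverts T" and MR: "M \<subseteq> pverts T - R"
    and m: "card M \<ge> 2" "card M + 2 \<le> card (pverts T - R)"
  shows "(\<Sum>x\<in>pverts T - R - M. min (card (M \<inter> out_nbrs x)) (card (M \<inter> in_nbrs x))) + card R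
    \<ge> 2 * k + 1"
proof (rule ccontr)
  assume neg: "\<not> ?thesis"
  let ?V' = "pverts T - R"
  let ?p = "\<lambda>z. int (card (M \<inter> out_nbrs z))" and ?q = "\<lambda>z. int (card (M \<inter> in_nbrs z))"
  define m l F where "m = int (card M)" and "l = int (card R)"
    and "F = (\<Sum>x\<in>?V' - M. min (?p x) (?q x))"
  have M: "M \<subseteq> pverts T"
    using MR by blast
  have fin: "finite (pverts T)" "finite R" "finite M"
    using R M pair_finite_verts finite_subset by blast+
  have m2: "m \<ge> 2"
    using assms by (simp add: m_def)
  have "card ?V' + card R = 4 * k + 3"
    using R fin card_V card_mono[of "pverts T" R] by (simp add: card_Diff_subset)
  then have ml: "m + 2 \<le> 4 * int k + 3 - l"
    using assms(6) by (simp add: m_def l_def)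
  have F: "F + l \<le> 2 * int k"
    using neg unfolding F_def l_def
    by (simp only: of_nat_min[symmetric] of_nat_sum[symmetric] of_nat_add[symmetric])
  have amgm: "4 * (a * b) \<le> (a + b)\<^sup>2" for a b :: int
    using sum_squares_ge_zero[of "a - b" 0] by (simp add: power2_eq_square algebra_simps)
  have pq_out: "?p z + ?q z = m" if "z \<in> pverts T - M" for z
    using card_nbrs_Int[OF M, of z] that by (simp add: m_def flip: of_nat_add)
  have pq_in: "?p z + ?q z = m - 1" if "z \<in> M" for z
    using card_nbrs_Int[OF M subsetD[OF M that]] that fin m2
    by (simp add: m_def of_nat_diff flip: of_nat_add)
  have m_pred: "int (card M - 1) = m - 1"
    using m2 by (simp add: m_def of_nat_diff)
  have "int (2 * (\<Sum>z\<in>pverts T. card (M \<inter> out_nbrs z) * card (M \<inter> in_nbrs z)))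
      = int (card M * (card M - 1) * (2 * k + 1))"
    by (simp only: sum_out_in_nbrs_Int[OF dr card_V M])
  then have tot: "2 * (\<Sum>z\<in>pverts T. ?p z * ?q z) = m * (m - 1) * (2 * int k + 1)"
    by (simp only: of_nat_mult of_nat_sum of_nat_add of_nat_1 of_nat_numeral m_pred m_def[symmetric])
  have "pverts T = M \<union> (R \<union> (?V' - M))"
    using R M by blast
  then have split: "(\<Sum>z\<in>pverts T. ?p z * ?q z)
      = (\<Sum>z\<in>M. ?p z * ?q z) + ((\<Sum>z\<in>R. ?p z * ?q z) + (\<Sum>z\<in>?V' - M. ?p z * ?q z))"
    using fin MR by (subst \<open>pverts T = _\<close>, subst sum.union_disjoint, simp, simp, blast,
        subst sum.union_disjoint) auto
  have "4 * (\<Sum>z\<in>M. ?p z * ?q z) \<le> (\<Sum>z\<in>M. (m - 1)\<^sup>2)"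
    unfolding sum_distrib_left by (rule sum_mono) (metis amgm pq_in)
  then have inM: "4 * (\<Sum>z\<in>M. ?p z * ?q z) \<le> m * (m - 1)\<^sup>2"
    by (simp add: m_def)
  have "4 * (\<Sum>z\<in>R. ?p z * ?q z) \<le> (\<Sum>z\<in>R. m\<^sup>2)"
    unfolding sum_distrib_left
  proof (rule sum_mono)
    fix z assume "z \<in> R"
    then have "z \<in> pverts T - M"
      using R MR by blast
    then show "4 * (?p z * ?q z) \<le> m\<^sup>2"
      by (metis amgm pq_out)
  qed
  then have inR: "4 * (\<Sum>z\<in>R. ?p z * ?q z) \<le> l * m\<^sup>2"
    by (simp add: l_def)
  have "(\<Sum>z\<in>?V' - M. ?p z * ?q z) \<le> (\<Sum>z\<in>?V' - M. (m - 1) * min (?p z) (?q z))"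
  proof (rule sum_mono)
    fix z assume z: "z \<in> ?V' - M"
    show "?p z * ?q z \<le> (m - 1) * min (?p z) (?q z)"
    \<comment> \<open>If both numbers are positive, the larger is at most \<open>m - 1\<close> as
      they sum to \<open>m\<close>; otherwise the product vanishes.\<close>
    proof (cases "min (?p z) (?q z) = 0")
      case False
      then have "max (?p z) (?q z) \<le> m - 1"
        using pq_out[of z] z by auto
      then have "max (?p z) (?q z) * min (?p z) (?q z) \<le> (m - 1) * min (?p z) (?q z)"
        by (intro mult_right_mono) auto
      then show ?thesis
        by (auto simp: max_def min_def mult.commute split: if_splits)
    qed (auto simp: min_def split: if_splits)
  qed
  then have outM: "(\<Sum>z\<in>?V' - M. ?p z * ?q z) \<le> (m - 1) * F"
    by (simp add: F_def sum_distrib_left)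
  \<comment> \<open>This weakening lets the factor \<open>m - 1\<close> be cancelled from every
    term.\<close>
  have "l * m\<^sup>2 \<le> l * ((m - 1) * (m + 2))"
    using m2 by (intro mult_left_mono) (auto simp: l_def power2_eq_square algebra_simps)
  moreover have "(m - 1) * F \<le> (m - 1) * (2 * int k - l)"
    using m2 F by (intro mult_left_mono) auto
  ultimately have "2 * (m * (m - 1) * (2 * int k + 1))
      \<le> m * (m - 1)\<^sup>2 + l * ((m - 1) * (m + 2)) + 4 * ((m - 1) * (2 * int k - l))"
    using tot split inM inR outM by linarith
  then have "(m - 1) * (2 * m * (2 * int k + 1))
      \<le> (m - 1) * (m * (m - 1) + l * (m + 2) + 4 * (2 * int k - l))"
    by (simp add: algebra_simps power2_eq_square)
  then have "2 * m * (2 * int k + 1) \<le> m * (m - 1) + l * (m + 2) + 4 * (2 * int k - l)"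
    using m2 by simp
  \<comment> \<open>The left side of the preceding inequality exceeds its right side by exactly this
    product plus 2. The two size bounds on \<open>M\<close> make the factors nonnegative.\<close>
  moreover have "(m - 2) * (4 * int k + 1 - l - m) \<ge> 0"
    using m2 ml by (intro mult_nonneg_nonneg) auto
  ultimately show False
    by (simp add: algebra_simps)
qed

end

section \<open>The simplicity index after removing vertices\<close>

theorem theorem1p2:
  fixes T :: "'a pair_pre_digraph" and k l :: nat and R :: "'a set"
  assumes "l \<in> {1, 2, 3}"
    and "k \<ge> l"
    and "doubly_regular T"
    and "card (pverts T) = 4 * k + 3"
    and "R \<subseteq> pverts T"
    and "card R = l"
  shows "simplicity_index (remove_verts T R) = (2 * k + 1) - l"
proof -
  let ?T' = "remove_verts T R"
  interpret tournament T
    using assms(3) by (simp add: doubly_regular_def)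
  interpret T': tournament ?T'
    by (rule tournament_remove_verts) unfold_locales
  have fin: "finite R"
    using assms(5) pair_finite_verts finite_subset by blast
  have verts': "pverts ?T' = pverts T - R"
    by (simp add: remove_verts_def)
  have card': "card (pverts ?T') = 4 * k + 3 - l"
    using assms fin by (simp add: verts' card_Diff_subset)
  have ge3: "card (pverts ?T') \<ge> 3"
    using card' assms(2) by simp
  have out': "T'.out_nbrs x = out_nbrs x - R" and in': "T'.in_nbrs x = in_nbrs x - R"
    if "x \<in> pverts T - R" for x
    using that by (auto simp: remove_verts_def)
  have out_ge: "card (T'.out_nbrs x) \<ge> 2 * k + 1 - l" and in_ge: "card (T'.in_nbrs x) \<ge> 2 * k + 1 - l"
    if "x \<in> pverts T - R" for x
    using that out'[OF that] in'[OF that] diff_card_le_card_Diff[OF fin, of "out_nbrs x"]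
      diff_card_le_card_Diff[OF fin, of "in_nbrs x"]
      doubly_regular_parameters(1)[OF assms(3,4), of x]
      card_in_nbrs_doubly_regular[OF assms(3,4), of x] assms(6) by auto
  \<comment> \<open>All \<open>l\<close> removed vertices lie on the same side of \<open>v\<close>,
    so one of its degrees drops by exactly \<open>l\<close>.\<close>
  obtain v where v: "v \<in> pverts T - R" and "R \<subseteq> out_nbrs v \<or> R \<subseteq> in_nbrs v"
    using exists_homogeneous_vertex[OF assms(3,4,5)] assms by auto
  then have "card (T'.out_nbrs v) = 2 * k + 1 - l \<or> card (T'.in_nbrs v) = 2 * k + 1 - l"
    using doubly_regular_parameters(1)[OF assms(3,4), of v]
      card_in_nbrs_doubly_regular[OF assms(3,4), of v] fin assms(6)
    by (auto simp: out'[OF v] in'[OF v] card_Diff_subset)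
  then have upper: "simplicity_index ?T' \<le> 2 * k + 1 - l"
    using T'.simplicity_index_le_out_degree[OF ge3, of v]
      T'.simplicity_index_le_in_degree[OF ge3, of v] v verts' by auto
  obtain B where B: "B \<subseteq> parcs ?T'" "card B = simplicity_index ?T'"
      "\<not> simple_tournament (reverse_arcs ?T' B)"
    using simplicity_index_attained[OF T'.tournament_axioms ge3] by blast
  then obtain M where M: "graph_module (reverse_arcs ?T' B) M"
      and nontriv: "\<not> trivial_module (reverse_arcs ?T' B) M"
    using ge3 tournament_reverse_arcs[OF T'.tournament_axioms B(1)]
    by (auto simp: simple_tournament_def reverse_arcs_def)
  have Msub: "M \<subseteq> pverts T - R"
    using M by (simp add: graph_module_def reverse_arcs_def verts')
  have nontriv: "M \<noteq> {}" "\<And>x. x \<in> pverts T - R \<Longrightarrow> M \<noteq> {x}" "M \<noteq> pverts T - R"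
    using nontriv by (auto simp: trivial_module_def reverse_arcs_def verts')
  have finM: "finite M" and finV': "finite (pverts T - R)"
    using Msub pair_finite_verts finite_subset by blast+
  have "card M \<noteq> 0" "card M \<noteq> 1"
    using nontriv(1,2) finM Msub by (auto simp: card_1_singleton_iff)
  then have m2: "card M \<ge> 2"
    by linarith
  have m_less: "card M < card (pverts T - R)"
    using Msub nontriv(3) finV' by (intro psubset_card_mono) auto
  have le_B: "(\<Sum>x\<in>pverts T - R - M. min (card (M \<inter> T'.out_nbrs x)) (card (M \<inter> T'.in_nbrs x))) \<le> card B"
    using T'.sum_min_nbrs_le_reversals[OF B(1) M] by (simp add: verts')
  have "2 * k + 1 - l \<le> card B"
  proof (cases "card M + 2 \<le> card (pverts T - R)")
    case True
    \<comment> \<open>Since \<open>M\<close> avoids \<open>R\<close>, neighbour counts in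
      \<open>M\<close> agree in \<open>T\<close> and \<open>?T'\<close>.\<close>
    have "M \<inter> T'.out_nbrs x = M \<inter> out_nbrs x" "M \<inter> T'.in_nbrs x = M \<inter> in_nbrs x"
      if "x \<in> pverts T - R - M" for x
      using that Msub out'[of x] in'[of x] by auto
    then show ?thesis
      using nonsimple_reversal_bound[OF assms(3,4,5) Msub m2 True] le_B assms(6) by simp
  next
    case False
    \<comment> \<open>With a single vertex \<open>x\<close> outside \<open>M\<close>, its neighbours
      in \<open>M\<close> are all its neighbours in \<open>?T'\<close>, so the degree bounds
      apply.\<close>
    then have "card (pverts T - R - M) = 1"
      using m_less Msub finM by (simp add: card_Diff_subset)
    then obtain x where x: "pverts T - R - M = {x}"
      by (auto simp: card_1_singleton_iff)
    then have xV: "x \<in> pverts T - R"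
      by blast
    have "y = x" if "y \<in> pverts T - R - M" for y
      using that x by simp
    then have "y \<in> M" if "(x, y) \<in> parcs ?T' \<or> (y, x) \<in> parcs ?T'" for y
      using that T'.arc_verts[of x y] T'.arc_verts[of y x] unfolding verts' by blast
    then have "M \<inter> T'.out_nbrs x = T'.out_nbrs x" "M \<inter> T'.in_nbrs x = T'.in_nbrs x"
      by blast+
    then have "min (card (T'.out_nbrs x)) (card (T'.in_nbrs x)) \<le> card B"
      using le_B x by simp
    then show ?thesis
      using out_ge[OF xV] in_ge[OF xV] by simp
  qed
  then show ?thesis
    using upper B(2) by simp
qed

end
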